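(* Let $f,g\in C_0(X)$ be nonzero. The semigroup $\mathcal S(f,g,\bar f,\bar g)$ is SI and nonsimple if and only if $\bar f=fW$ and $\bar g=gW'$ for some words $W$ and $W'$ in $f,g,\bar f,\bar g,1$ such that: if $g$ appears in $W$ (or $\bar g$ appears in $W$; it is not necessary to check both), then $W'$ must be a word in $g,\bar g$ only; and similarly, if $f$ appears in $W'$ (or $\bar f$ appears in $W'$; it is not necessary to check both), then $W$ must be a word in $f,\bar f$ only. (Of course then, if both $W$ is $g$ free and $W'$ is $f$ free, there is nothing to check.)
   Context: $X=\Omega(\mathcal A)$ is the locally compact Hausdorff space of characters (nonzero complex-valued homomorphisms) of a nonzero abelian $C^*$-algebra $\mathcal A$, and $C_0(X)$ is the $C^*$-algebra of continuous complex-valued functions on $X$ vanishing at infinity, i.e. the range of the Gelfand representation of $\mathcal A$; $\bar f$ is the complex conjugate of $f$. $\mathcal S(f,g,\bar f,\bar g)$ is the multiplicative semigroup generated by $f,g,\bar f,\bar g$, i.e. the set of all finite products of these functions. A word in given letters is a finite product of those letters; $1$ denotes the constant function $1$ (which need not belong to the semigroup). An ideal of a semigroup $\mathcal S$ is a nonempty subset $J\subset\mathcal S$ with $xa,ay\in J$ for all $a\in J$ and $x,y\in\mathcal S$. $\mathcal S$ is simple if it has no proper ideals, and nonsimple otherwise. $\mathcal S$ is an SI (selfadjoint-ideal) semigroup if every ideal $J$ of $\mathcal S$ is closed under the involution (here complex conjugation).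
   Formalization: "For some words W, W' such that" is replaced by: such words exist, and every pair with f̄=fW, ḡ=gW' meets the letter condition. The original fails for X a point, f=g=1 (S={1} is simple, W=W'=1). The letter 1 is allowed in "words in g, ḡ only" (likewise f, f̄). *)

theory Defs
  imports "HOL-Analysis.Analysis" "HOL-Library.Function_Algebras"
begin

text \<open>Not necessarily unital abelian C*-algebras. The real scaling inherited from
  the class \<^class>\<open>banach\<close> is the restriction of the complex one.\<close>

class abelian_cstar_algebra = banach + real_normed_algebra + comm_ring +
  fixes cscale :: "complex \<Rightarrow> 'a \<Rightarrow> 'a"
    and star :: "'a \<Rightarrow> 'a"
  assumes cscale_add_right: "cscale c (x + y) = cscale c x + cscale c y"
    and cscale_add_left: "cscale (c + d) x = cscale c x + cscale d x"
    and cscale_cscale: "cscale c (cscale d x) = cscale (c * d) x"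
    and cscale_of_real: "cscale (complex_of_real r) x = r *\<^sub>R x"
    and cscale_mult_left: "cscale c x * y = cscale c (x * y)"
    and norm_cscale: "norm (cscale c x) = cmod c * norm x"
    and star_add: "star (x + y) = star x + star y"
    and star_cscale: "star (cscale c x) = cscale (cnj c) (star x)"
    and star_mult: "star (x * y) = star y * star x"
    and star_star: "star (star x) = x"
    and cstar_identity: "norm (star x * x) = (norm x)\<^sup>2"

definition is_character :: "('a::abelian_cstar_algebra \<Rightarrow> complex) \<Rightarrow> bool" where
  "is_character \<phi> \<longleftrightarrow>
     (\<forall>x y. \<phi> (x + y) = \<phi> x + \<phi> y) \<and>
     (\<forall>c x. \<phi> (cscale c x) = c * \<phi> x) \<and>
     (\<forall>x y. \<phi> (x * y) = \<phi> x * \<phi> y) \<and>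
     (\<exists>x. \<phi> x \<noteq> 0)"

text \<open>The topology on the type \<open>'a \<Rightarrow> complex\<close> is the product topology, so the subspace
  topology below is that of pointwise convergence (the weak-* topology).\<close>

definition character_space :: "('a::abelian_cstar_algebra \<Rightarrow> complex) topology" where
  "character_space = top_of_set {\<phi>. is_character \<phi>}"

text \<open>Functions on \<open>X\<close> are total functions that are \<open>0\<close> outside \<open>topspace X\<close>, so that
  equality of members of \<open>C0 X\<close> is equality on \<open>X\<close>.\<close>

definition C0 :: "'x topology \<Rightarrow> ('x \<Rightarrow> complex) set" where
  "C0 X = {f. continuous_map X euclidean f \<and>
              (\<forall>e>0. compactin X {x \<in> topspace X. e \<le> cmod (f x)}) \<and>
              (\<forall>x. x \<notin> topspace X \<longrightarrow> f x = 0)}"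

text \<open>Products of functions, and the functions \<open>0\<close> and \<open>1\<close>, are the pointwise ones of
  \<^theory>\<open>HOL-Library.Function_Algebras\<close>.\<close>

definition conj_fun :: "('x \<Rightarrow> complex) \<Rightarrow> 'x \<Rightarrow> complex" where
  "conj_fun f = (\<lambda>x. cnj (f x))"

definition generated_semigroup :: "'s::monoid_mult set \<Rightarrow> 's set" where
  "generated_semigroup A = {prod_list ws | ws. ws \<noteq> [] \<and> set ws \<subseteq> A}"

definition semigroup_ideal :: "'s::semigroup_mult set \<Rightarrow> 's set \<Rightarrow> bool" where
  "semigroup_ideal S J \<longleftrightarrow>
     J \<noteq> {} \<and> J \<subseteq> S \<and> (\<forall>a\<in>J. \<forall>x\<in>S. \<forall>y\<in>S. x * a \<in> J \<and> a * y \<in> J)"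

definition simple_semigroup :: "'s::semigroup_mult set \<Rightarrow> bool" where
  "simple_semigroup S \<longleftrightarrow> \<not> (\<exists>J. semigroup_ideal S J \<and> J \<noteq> S)"

definition SI_semigroup :: "('x \<Rightarrow> complex) set \<Rightarrow> bool" where
  "SI_semigroup S \<longleftrightarrow> (\<forall>J. semigroup_ideal S J \<longrightarrow> (\<forall>a\<in>J. conj_fun a \<in> J))"

text \<open>Words are formal: whether a letter appears in a word depends on the word and not on
  the function it denotes (\<open>f\<close>, \<open>g\<close> and their conjugates may coincide as functions). The
  empty word denotes the constant function \<open>1\<close>, just as the one-letter word \<open>[L1]\<close> does.\<close>

datatype letter = Lf | Lg | Lfbar | Lgbar | L1

fun letter_val :: "('x \<Rightarrow> complex) \<Rightarrow> ('x \<Rightarrow> complex) \<Rightarrow> letter \<Rightarrow> 'x \<Rightarrow> complex" where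
  "letter_val f g Lf = f"
| "letter_val f g Lg = g"
| "letter_val f g Lfbar = conj_fun f"
| "letter_val f g Lgbar = conj_fun g"
| "letter_val f g L1 = 1"

definition word_val ::
    "('x \<Rightarrow> complex) \<Rightarrow> ('x \<Rightarrow> complex) \<Rightarrow> letter list \<Rightarrow> 'x \<Rightarrow> complex" where
  "word_val f g W = prod_list (map (letter_val f g) W)"

text \<open>The pair \<open>(W, W')\<close> expresses the conjugates of \<open>f\<close> and \<open>g\<close> as \<open>f W\<close> and \<open>g W'\<close>.\<close>

definition conj_words ::
    "('x \<Rightarrow> complex) \<Rightarrow> ('x \<Rightarrow> complex) \<Rightarrow> letter list \<Rightarrow> letter list \<Rightarrow> bool" where
  "conj_words f g W W' \<longleftrightarrow>
     conj_fun f = f * word_val f g W \<and> conj_fun g = g * word_val f g W'"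

text \<open>The letter \<open>L1\<close> is allowed in a word ``in \<open>g\<close> and its conjugate only'': for
  selfadjoint \<open>g\<close>, the word \<open>W' = 1\<close> may be the only one available.\<close>

definition compatible_words :: "letter list \<Rightarrow> letter list \<Rightarrow> bool" where
  "compatible_words W W' \<longleftrightarrow>
     (Lg \<in> set W \<or> Lgbar \<in> set W \<longrightarrow> set W' \<subseteq> {Lg, Lgbar, L1}) \<and>
     (Lf \<in> set W' \<or> Lfbar \<in> set W' \<longrightarrow> set W \<subseteq> {Lf, Lfbar, L1})"

end

theory Submission
  imports Defs
begin

text \<open>Let \<open>S\<close> be the semigroup generated by \<open>f\<close>, \<open>g\<close> and their conjugates.
  If \<open>S\<close> is SI, then the principal ideals
  \<open>f S \<union> {f}\<close> and \<open>g S \<union> {g}\<close> contain the conjugates of \<open>f\<close> and \<open>g\<close>, which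
  yields \<open>W\<close> and \<open>W'\<close>; conversely such words make every element of \<open>S\<close> divide its own
  conjugate. Suppose that \<open>g\<close> or its conjugate occurs in \<open>W\<close>, and \<open>f\<close> or its conjugate
  in \<open>W'\<close>. Then \<open>E = W conj W\<close> fixes \<open>f\<close> and is divisible by \<open>g\<close>, while
  \<open>E' = W' conj W'\<close> fixes \<open>g\<close> and is divisible by \<open>f\<close>. Hence \<open>E = E E' = E'\<close> is an
  identity of \<open>S\<close> divisible by every generator, so \<open>S\<close> is a group and therefore simple.
  Conversely, if \<open>S\<close> is simple, then it equals its ideal \<open>f g S\<close>, and reading the conjugates
  of \<open>f\<close> and \<open>g\<close> as elements of this ideal gives an incompatible pair of words.\<close>

section \<open>Generated semigroups, their ideals and simplicity\<close>

lemma generated_semigroup_generator: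
  "a \<in> A \<Longrightarrow> a \<in> generated_semigroup A"
  unfolding generated_semigroup_def by (auto intro!: exI[of _ "[a]"])

lemma generated_semigroup_mult:
  assumes "a \<in> generated_semigroup A" "b \<in> generated_semigroup A"
  shows "a * b \<in> generated_semigroup A"
proof -
  obtain u v where "a = prod_list u" "u \<noteq> []" "set u \<subseteq> A" "b = prod_list v" "set v \<subseteq> A"
    using assms unfolding generated_semigroup_def by auto
  then have "a * b = prod_list (u @ v) \<and> u @ v \<noteq> [] \<and> set (u @ v) \<subseteq> A"
    by simp
  then show ?thesis
    unfolding generated_semigroup_def by blast
qed

text \<open>\<open>insert 1 (generated_semigroup A)\<close> adjoins an identity to the semigroup,
  which need not contain 1; cofactors in divisibility statements range over it.\<close>

lemma generated_semigroup_mult_1: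
  assumes "a \<in> insert 1 (generated_semigroup A)" "b \<in> insert 1 (generated_semigroup A)"
  shows "a * b \<in> insert 1 (generated_semigroup A)"
  using assms by (auto intro: generated_semigroup_mult)

lemma generated_semigroup_mult_1_right:
  assumes "a \<in> generated_semigroup A" "b \<in> insert 1 (generated_semigroup A)"
  shows "a * b \<in> generated_semigroup A"
  using assms by (auto intro: generated_semigroup_mult)

lemma generated_semigroup_induct [consumes 1, case_names generator mult]:
  assumes "x \<in> generated_semigroup A"
    and gen: "\<And>a. a \<in> A \<Longrightarrow> P a"
    and mult: "\<And>a y. a \<in> A \<Longrightarrow> y \<in> generated_semigroup A \<Longrightarrow> P y \<Longrightarrow> P (a * y)"
  shows "P x"
proof -
  have "P (prod_list ws)" if "ws \<noteq> []" "set ws \<subseteq> A" for ws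
    using that
  proof (induction ws rule: list_nonempty_induct)
    case (single a)
    then show ?case using gen by simp
  next
    case (cons a ws)
    then have "prod_list ws \<in> generated_semigroup A"
      unfolding generated_semigroup_def by auto
    with cons show ?case using mult by simp
  qed
  then show ?thesis
    using assms(1) unfolding generated_semigroup_def by auto
qed

text \<open>Applied with \<open>T = insert 1 S\<close> to obtain the principal ideal of
  \<open>a\<close>, and with \<open>T = S\<close> to obtain \<open>a S\<close>.\<close>

lemma multiples_ideal:
  fixes S T :: "'s::comm_monoid_mult set"
  assumes "T \<noteq> {}" and "\<And>t. t \<in> T \<Longrightarrow> a * t \<in> S"
    and T: "\<And>t x. t \<in> T \<Longrightarrow> x \<in> S \<Longrightarrow> t * x \<in> T"
  shows "semigroup_ideal S ((*) a ` T)"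
  unfolding semigroup_ideal_def
proof (intro conjI ballI)
  show "(*) a ` T \<noteq> {}" "(*) a ` T \<subseteq> S"
    using assms by auto
  fix b x y assume "b \<in> (*) a ` T" "x \<in> S" "y \<in> S"
  then obtain t where t: "t \<in> T" "b = a * t" by blast
  have "x * b = a * (t * x)" "b * y = a * (t * y)" by (simp_all add: t ac_simps)
  with T t(1) \<open>x \<in> S\<close> \<open>y \<in> S\<close> show "x * b \<in> (*) a ` T" "b * y \<in> (*) a ` T"
    by simp_all
qed

text \<open>Being fixed by \<open>E\<close> and dividing \<open>E\<close> both pass from generators
  to products, so the semigroup is an abelian group with identity \<open>E\<close>. An ideal then
  contains \<open>E\<close>, hence everything.\<close>

lemma simple_semigroup_if_divides_identity:
  fixes A :: "'s::comm_monoid_mult set"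
  assumes E: "E \<in> generated_semigroup A"
    and identity: "\<And>a. a \<in> A \<Longrightarrow> a * E = a"
    and divides: "\<And>a. a \<in> A \<Longrightarrow> \<exists>v \<in> insert 1 (generated_semigroup A). a * v = E"
  shows "simple_semigroup (generated_semigroup A)"
proof -
  let ?S = "generated_semigroup A"
  have id: "x * E = x" if "x \<in> ?S" for x
    using that
  proof (induction rule: generated_semigroup_induct)
    case (mult a y)
    then show ?case by (simp add: mult.assoc)
  qed (rule identity)
  have inv: "\<exists>y\<in>?S. x * y = E" if "x \<in> ?S" for x
    using that
  proof (induction rule: generated_semigroup_induct)
    case (generator a)
    then obtain v where v: "v \<in> insert 1 ?S" "a * v = E" using divides by blast
    \<comment> \<open>The cofactor \<open>v\<close> may be 1, outside the semigroup; the factor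
      \<open>E\<close> brings it inside.\<close>
    have "E * v \<in> ?S" using E v(1) by (rule generated_semigroup_mult_1_right)
    moreover have "a * (E * v) = E" using v(2) id[OF E] by (metis mult.assoc mult.commute)
    ultimately show ?case by blast
  next
    case (mult a y)
    then obtain z v where z: "z \<in> ?S" "y * z = E" and v: "v \<in> insert 1 ?S" "a * v = E"
      using divides by blast
    have "z * v \<in> ?S" using z(1) v(1) by (rule generated_semigroup_mult_1_right)
    moreover have "a * y * (z * v) = (a * v) * (y * z)" by (simp add: ac_simps)
    ultimately show ?case using z v id[OF E] by auto
  qed
  have "J = ?S" if J: "semigroup_ideal ?S J" for J
  proof -
    obtain a where a: "a \<in> J" "a \<in> ?S" using J unfolding semigroup_ideal_def by blast
    then obtain y where "y \<in> ?S" "a * y = E" using inv by blast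
    then have "E \<in> J" using J a unfolding semigroup_ideal_def by metis
    then have "x \<in> J" if "x \<in> ?S" for x
      using J id[OF that] that unfolding semigroup_ideal_def by metis
    then show "J = ?S" using J unfolding semigroup_ideal_def by blast
  qed
  then show ?thesis unfolding simple_semigroup_def by blast
qed

section \<open>Complex conjugation and the SI property\<close>

lemma conj_fun_mult: "conj_fun (a * b) = conj_fun a * conj_fun b"
  by (auto simp: conj_fun_def)

lemma conj_fun_one [simp]: "conj_fun 1 = 1"
  by (auto simp: conj_fun_def)

lemma conj_fun_conj_fun [simp]: "conj_fun (conj_fun a) = a"
  by (auto simp: conj_fun_def)

lemma conj_fun_generated_semigroup:
  assumes "a \<in> generated_semigroup A" and "\<And>a. a \<in> A \<Longrightarrow> conj_fun a \<in> A"
  shows "conj_fun a \<in> generated_semigroup A"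
  using assms(1)
proof (induction rule: generated_semigroup_induct)
  case (generator a)
  then show ?case using assms(2) generated_semigroup_generator by blast
next
  case (mult a y)
  then show ?case
    using assms(2) generated_semigroup_generator generated_semigroup_mult
    by (metis conj_fun_mult)
qed

text \<open>Conjugation is multiplicative, so dividing one's own conjugate passes to products;
  ideals absorb the cofactor.\<close>

lemma SI_semigroupI:
  assumes "\<And>a. a \<in> A \<Longrightarrow> \<exists>t \<in> insert 1 (generated_semigroup A). conj_fun a = a * t"
  shows "SI_semigroup (generated_semigroup A)"
proof -
  let ?S = "generated_semigroup A"
  have "\<exists>t \<in> insert 1 ?S. conj_fun a = a * t" if "a \<in> ?S" for a
    using that
  proof (induction rule: generated_semigroup_induct)
    case (mult a y)
    then obtain s t where s: "s \<in> insert 1 ?S" "conj_fun a = a * s"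
      and t: "t \<in> insert 1 ?S" "conj_fun y = y * t"
      using assms by blast
    have "conj_fun (a * y) = a * y * (s * t)"
      by (simp add: conj_fun_mult s t ac_simps)
    with generated_semigroup_mult_1[OF s(1) t(1)] show ?case by blast
  qed (rule assms)
  moreover have "a * t \<in> J" if "semigroup_ideal ?S J" "a \<in> J" "t \<in> insert 1 ?S" for J a t
    using that unfolding semigroup_ideal_def by (metis insert_iff mult.right_neutral)
  moreover have "J \<subseteq> ?S" if "semigroup_ideal ?S J" for J
    using that unfolding semigroup_ideal_def by blast
  ultimately show ?thesis
    unfolding SI_semigroup_def by (metis subsetD)
qed

section \<open>Words as elements of the semigroup with 1 adjoined\<close>

abbreviation conj_semigroup ::
    "('x \<Rightarrow> complex) \<Rightarrow> ('x \<Rightarrow> complex) \<Rightarrow> ('x \<Rightarrow> complex) set" where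
  "conj_semigroup f g \<equiv> generated_semigroup {f, g, conj_fun f, conj_fun g}"

lemma conj_fun_conj_semigroup:
  "a \<in> conj_semigroup f g \<Longrightarrow> conj_fun a \<in> conj_semigroup f g"
  by (rule conj_fun_generated_semigroup) auto

lemma letter_val_in_conj_semigroup:
  "letter_val f g l \<in> insert 1 (conj_semigroup f g)"
  by (cases l) (auto intro: generated_semigroup_generator)

lemma word_val_Cons [simp]: "word_val f g (l # W) = letter_val f g l * word_val f g W"
  by (simp add: word_val_def)

lemma word_val_Nil [simp]: "word_val f g [] = 1"
  by (simp add: word_val_def)

lemma word_val_in_conj_semigroup:
  "word_val f g W \<in> insert 1 (conj_semigroup f g)"
proof (induction W)
  case (Cons l W)
  show ?case
    unfolding word_val_Cons
    using letter_val_in_conj_semigroup Cons by (rule generated_semigroup_mult_1)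
qed simp

lemma conj_semigroup_word:
  assumes "t \<in> insert 1 (conj_semigroup f g)"
  obtains W where "t = word_val f g W"
proof -
  have "\<exists>W. t = word_val f g W" if "t \<in> conj_semigroup f g"
    using that
  proof (induction rule: generated_semigroup_induct)
    case (generator a)
    then obtain l where "a = letter_val f g l"
      by (metis insertE emptyE letter_val.simps)
    then have "a = word_val f g [l]" by simp
    then show ?case by blast
  next
    case (mult a y)
    then obtain l W where "a = letter_val f g l" "y = word_val f g W"
      by (metis insertE emptyE letter_val.simps)
    then have "a * y = word_val f g (l # W)" by simp
    then show ?case by blast
  qed
  moreover have "1 = word_val f g []" by simp
  ultimately show ?thesis using assms that by blast
qed

lemma word_val_remove1:
  "l \<in> set W \<Longrightarrow> word_val f g W = letter_val f g l * word_val f g (remove1 l W)"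
  by (induction W) (auto simp: mult.left_commute)

text \<open>The factor split off is the same for a letter and its conjugate, so a single argument
  covers the occurrence of either.\<close>

lemma word_val_mult_conj_letter:
  fixes f g :: "'x \<Rightarrow> complex"
  assumes "l \<in> set W"
  obtains v where "v \<in> insert 1 (conj_semigroup f g)"
    "word_val f g W * conj_fun (word_val f g W)
       = letter_val f g l * conj_fun (letter_val f g l) * v"
proof
  let ?u = "word_val f g (remove1 l W)"
  have "conj_fun ?u \<in> insert 1 (conj_semigroup f g)"
    using word_val_in_conj_semigroup[of f g "remove1 l W"] conj_fun_conj_semigroup by auto
  with word_val_in_conj_semigroup
  show "?u * conj_fun ?u \<in> insert 1 (conj_semigroup f g)"
    by (rule generated_semigroup_mult_1)
  show "word_val f g W * conj_fun (word_val f g W)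
       = letter_val f g l * conj_fun (letter_val f g l) * (?u * conj_fun ?u)"
    using word_val_remove1[OF assms, of f g] by (simp add: conj_fun_mult ac_simps)
qed

lemma all_letter: "(\<forall>l. P l) \<longleftrightarrow> P Lf \<and> P Lg \<and> P Lfbar \<and> P Lgbar \<and> P L1"
  by (intro iffI allI) (simp, rule letter.induct, auto)

text \<open>The two implications in \<open>compatible_words\<close> are contrapositives of each
  other, so they fail together.\<close>

lemma incompatible_words_iff:
  "\<not> compatible_words W W' \<longleftrightarrow>
     (Lg \<in> set W \<or> Lgbar \<in> set W) \<and> (Lf \<in> set W' \<or> Lfbar \<in> set W')"
proof -
  have "{Lg, Lgbar, L1} = - {Lf, Lfbar}" "{Lf, Lfbar, L1} = - {Lg, Lgbar}"
    by (simp_all add: set_eq_iff all_letter)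
  then have "set V \<subseteq> {Lg, Lgbar, L1} \<longleftrightarrow> \<not> (Lf \<in> set V \<or> Lfbar \<in> set V)"
    "set V \<subseteq> {Lf, Lfbar, L1} \<longleftrightarrow> \<not> (Lg \<in> set V \<or> Lgbar \<in> set V)" for V
    by auto
  then show ?thesis unfolding compatible_words_def by blast
qed

section \<open>SI versus words, and simplicity versus incompatible words\<close>

lemma SI_if_conj_words:
  assumes "conj_words f g W W'"
  shows "SI_semigroup (conj_semigroup f g)"
proof (rule SI_semigroupI)
  let ?S = "conj_semigroup f g"
  fix a assume "a \<in> {f, g, conj_fun f, conj_fun g}"
  moreover have f: "conj_fun f = f * word_val f g W"
    and g: "conj_fun g = g * word_val f g W'"
    using assms unfolding conj_words_def by auto
  \<comment> \<open>Conjugating both equations treats the generators \<open>conj_fun f\<close> and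
    \<open>conj_fun g\<close>.\<close>
  moreover have "f = conj_fun f * conj_fun (word_val f g W)"
    "g = conj_fun g * conj_fun (word_val f g W')"
    using f g by (metis conj_fun_conj_fun conj_fun_mult)+
  moreover have "conj_fun (word_val f g V) \<in> insert 1 ?S" for V
    using word_val_in_conj_semigroup[of f g V] conj_fun_conj_semigroup by auto
  ultimately show "\<exists>t \<in> insert 1 ?S. conj_fun a = a * t"
    using word_val_in_conj_semigroup[of f g] by (metis conj_fun_conj_fun insertE emptyE)
qed

lemma conj_words_if_SI:
  assumes "SI_semigroup (conj_semigroup f g)"
  shows "\<exists>W W'. conj_words f g W W'"
proof -
  let ?S = "conj_semigroup f g"
  have "\<exists>W. conj_fun h = h * word_val f g W" if h: "h \<in> {f, g}" for h
  proof -
    have "h \<in> ?S" using h by (intro generated_semigroup_generator) auto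
    \<comment> \<open>Adjoining 1 puts \<open>h\<close> itself into the ideal.\<close>
    then have "semigroup_ideal ?S ((*) h ` insert 1 ?S)"
      by (intro multiples_ideal generated_semigroup_mult_1 generated_semigroup_mult_1_right) auto
    moreover have "h \<in> (*) h ` insert 1 ?S" by (auto intro: image_eqI[of _ _ 1])
    ultimately have "conj_fun h \<in> (*) h ` insert 1 ?S"
      using assms unfolding SI_semigroup_def by blast
    then obtain t where "t \<in> insert 1 ?S" "conj_fun h = h * t" by blast
    then show ?thesis using conj_semigroup_word by metis
  qed
  then show ?thesis unfolding conj_words_def by blast
qed

lemma simple_if_incompatible_words:
  assumes "conj_words f g W W'" and "\<not> compatible_words W W'"
  shows "simple_semigroup (conj_semigroup f g)"
proof -
  let ?S = "conj_semigroup f g"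
  define E where "E = word_val f g W * conj_fun (word_val f g W)"
  define E' where "E' = word_val f g W' * conj_fun (word_val f g W')"
  \<comment> \<open>Since \<open>E\<close> is selfadjoint, it fixes the conjugate of whatever it
    fixes.\<close>
  have conj_E: "conj_fun E = E"
    by (simp add: E_def conj_fun_mult mult.commute)
  have cf: "conj_fun f = f * word_val f g W" and cg: "conj_fun g = g * word_val f g W'"
    using assms(1) unfolding conj_words_def by auto
  \<comment> \<open>Conjugating \<open>cf\<close> gives
    \<open>f = conj_fun f * conj_fun (word_val f g W)\<close>; then substitute \<open>cf\<close>
    again.\<close>
  have fE: "f * E = f"
    using cf unfolding E_def by (metis conj_fun_conj_fun conj_fun_mult mult.assoc)
  have gE': "g * E' = g"
    using cg unfolding E'_def by (metis conj_fun_conj_fun conj_fun_mult mult.assoc)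
  obtain l l' where l: "l \<in> set W" "l \<in> {Lg, Lgbar}" and l': "l' \<in> set W'" "l' \<in> {Lf, Lfbar}"
    using assms(2) unfolding incompatible_words_iff by blast
  have "letter_val f g l * conj_fun (letter_val f g l) = g * conj_fun g"
    using l(2) by (auto simp: mult.commute)
  then obtain v where v: "v \<in> insert 1 ?S" "E = g * (conj_fun g * v)"
    using word_val_mult_conj_letter[OF l(1), of f g] unfolding E_def by (metis mult.assoc)
  have "letter_val f g l' * conj_fun (letter_val f g l') = f * conj_fun f"
    using l'(2) by (auto simp: mult.commute)
  then obtain v' where v': "v' \<in> insert 1 ?S" "E' = f * (conj_fun f * v')"
    using word_val_mult_conj_letter[OF l'(1), of f g] unfolding E'_def by (metis mult.assoc)
  \<comment> \<open>\<open>E'\<close> fixes \<open>E\<close>, a multiple of \<open>g\<close>;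
    likewise \<open>E\<close> fixes \<open>E'\<close>, a multiple of \<open>f\<close>.\<close>
  have "E = E * E'" using v(2) gE' by (metis mult.assoc mult.commute)
  also have "\<dots> = E'" using v'(2) fE by (metis mult.assoc mult.commute)
  finally have eq: "E = E'" .
  have gens: "f \<in> ?S" "g \<in> ?S" "conj_fun f \<in> ?S" "conj_fun g \<in> ?S"
    by (auto intro: generated_semigroup_generator)
  show ?thesis
  proof (rule simple_semigroup_if_divides_identity)
    show "E \<in> ?S"
      unfolding v(2) using gens v(1)
      by (intro generated_semigroup_mult generated_semigroup_mult_1_right)
  next
    fix a assume "a \<in> {f, g, conj_fun f, conj_fun g}"
    then show "a * E = a"
      using fE gE' eq conj_E by (metis conj_fun_mult insertE emptyE)
  next
    fix a assume a: "a \<in> {f, g, conj_fun f, conj_fun g}"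
    have "h * v \<in> insert 1 ?S" "h * v' \<in> insert 1 ?S" if "h \<in> ?S" for h
      using that v(1) v'(1) by (auto intro: generated_semigroup_mult)
    moreover have "conj_fun g * (g * v) = E" "conj_fun f * (f * v') = E"
      using v(2) v'(2) eq by (simp_all add: mult.left_commute)
    ultimately show "\<exists>w \<in> insert 1 ?S. a * w = E"
      using a v(2) v'(2) eq gens by (metis insertE emptyE)
  qed
qed

lemma incompatible_words_if_simple:
  assumes "simple_semigroup (conj_semigroup f g)"
  shows "\<exists>W W'. conj_words f g W W' \<and> \<not> compatible_words W W'"
proof -
  let ?S = "conj_semigroup f g"
  have "f * g \<in> ?S"
    by (intro generated_semigroup_mult generated_semigroup_generator) auto
  then have "semigroup_ideal ?S ((*) (f * g) ` ?S)"
    by (intro multiples_ideal) (auto intro: generated_semigroup_mult)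
  then have "(*) (f * g) ` ?S = ?S"
    using assms unfolding simple_semigroup_def by blast
  moreover have "conj_fun f \<in> ?S" "conj_fun g \<in> ?S"
    by (auto intro: generated_semigroup_generator)
  ultimately have "conj_fun f \<in> (*) (f * g) ` ?S" "conj_fun g \<in> (*) (f * g) ` ?S"
    by simp_all
  then obtain s t where "s \<in> ?S" "conj_fun f = f * g * s" "t \<in> ?S" "conj_fun g = f * g * t"
    by blast
  moreover from this obtain U V where "s = word_val f g U" "t = word_val f g V"
    using conj_semigroup_word by (metis insertI2)
  \<comment> \<open>The factor \<open>f * g\<close> supplies the formal letter \<open>Lg\<close> in
    the first word and \<open>Lf\<close> in the second.\<close>
  ultimately have "conj_words f g (Lg # U) (Lf # V)"
    unfolding conj_words_def by (simp add: ac_simps)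
  moreover have "\<not> compatible_words (Lg # U) (Lf # V)"
    unfolding incompatible_words_iff by simp
  ultimately show ?thesis by blast
qed

theorem theorem2p5:
  fixes f g :: "('a::abelian_cstar_algebra \<Rightarrow> complex) \<Rightarrow> complex"
  assumes "\<exists>x::'a. x \<noteq> 0"
    and "f \<in> C0 character_space" and "g \<in> C0 character_space"
    and "f \<noteq> 0" and "g \<noteq> 0"
  shows "SI_semigroup (generated_semigroup {f, g, conj_fun f, conj_fun g}) \<and>
         \<not> simple_semigroup (generated_semigroup {f, g, conj_fun f, conj_fun g}) \<longleftrightarrow>
         (\<exists>W W'. conj_words f g W W') \<and>
         (\<forall>W W'. conj_words f g W W' \<longrightarrow> compatible_words W W')"
  \<comment> \<open>SI is equivalent to the existence of a pair of words, and simplicity to that of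
    an incompatible pair.\<close>
  using SI_if_conj_words[of f g] conj_words_if_SI[of f g]
    simple_if_incompatible_words[of f g] incompatible_words_if_simple[of f g]
  by blast

end
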